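(* Let $\alpha,\beta,\gamma\in\mathbb C$ with $\alpha\ne0$, and let $c$ be the three-parameter cocycle on $\mathfrak k^{L0}(1|4)$, i.e. the super skew-symmetric bilinear form whose only nonzero values on the natural basis $L_m,\ T^{ij}_m,\ S_m\,(m\neq0),\ E^i_m,\ F^i_m$ (up to super skew-symmetry in the arguments) are $$c(L_m,L_n)=\alpha m(m^2-1)\delta_{m+n,0},\quad c(E^i_m,E^i_n)=\alpha m(m+1)\delta_{m+n+1,0},\quad c(T^{ij}_m,T^{ij}_n)=\alpha m\,\delta_{m+n,0},$$ $$c(F^i_m,F^i_n)=\alpha\,\delta_{m+n+1,0},\quad c(S_m,S_n)=\tfrac{\alpha}{m}\delta_{m+n,0},\quad c(L_m,S_n)=(\gamma+\beta m)\delta_{m+n,0},$$ $$c(E^i_m,F^i_n)=\big(\tfrac12\gamma+\beta(m+\tfrac12)\big)\delta_{m+n+1,0},\quad c(T^{ij}_m,T^{kl}_n)=-\beta m\,\delta_{m+n,0}\ \text{ for } (i,j,k,l) \text{ an even permutation of }(1,2,3,4).$$ Put $$\tilde L_m=L_m+a_mS_m,\quad a_m=-\tfrac{\beta}{\alpha}m^2-\tfrac{\gamma}{\alpha}m;\qquad \tilde E^i_m=E^i_m+b_mF^i_m,\quad b_m=\tfrac{\beta}{2\alpha}(2m+1)+\tfrac{\gamma}{2\alpha}$$ (so $\tilde L_0=L_0$). Then in the basis $\tilde L_m,\ T^{ij}_m,\ S_m,\ \tilde E^i_m,\ F^i_m$ the only nonzero values of $c$ (up to super skew-symmetry) are $$c(\tilde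 L_m,\tilde L_n)=\Big(\tfrac{\alpha^2-\beta^2}{\alpha}m^3-\tfrac{\alpha^2-\gamma^2}{\alpha}m\Big)\delta_{m+n,0},$$ $$c(\tilde E^i_m,\tilde E^i_n)=\Big(\tfrac{\alpha^2-3\beta^2}{\alpha}(m+\tfrac12)^2-\tfrac{\alpha^2-3\gamma^2}{4\alpha}\Big)\delta_{m+n+1,0},$$ $$c(T^{ij}_m,T^{ij}_n)=\alpha m\,\delta_{m+n,0},\quad c(F^i_m,F^i_n)=\alpha\,\delta_{m+n+1,0},\quad c(S_m,S_n)=\tfrac{\alpha}{m}\delta_{m+n,0},$$ $$c(\tilde E^i_m,F^i_n)=\big(\gamma+\beta(2m+1)\big)\delta_{m+n+1,0},\quad c(T^{ij}_m,T^{kl}_n)=-\beta m\,\delta_{m+n,0}\ \text{ for }(i,j,k,l)\text{ an even permutation of }(1,2,3,4).$$ In particular $c(\tilde L_m,S_n)=0$ for all $m$ and all $n\ne 0$.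
   Context: $\mathfrak k^L(1|4)$ is the Lie superalgebra of contact vector fields $K_f$ with generating functions $f\in\mathbb C[t^{-1},t,\theta_1,\theta_2,\theta_3,\theta_4]$ ($t$ even, $\theta_i$ odd), and $\mathfrak k^{L0}(1|4)$ is its codimension one ideal spanned by the $K_f$ such that the coefficient of $t^{-1}\theta_1\theta_2\theta_3\theta_4$ in $f$ is zero. Its natural basis is, for $m\in\mathbb Z$ and $1\le i,j\le4$: even elements $L_m=K_{t^{m+1}}$, $T^{ij}_m=K_{t^m\theta_i\theta_j}$ (so $T^{ji}_m=-T^{ij}_m$; take $i<j$ for a basis), $S_m=K_{t^{m-1}\theta_1\theta_2\theta_3\theta_4}$ with $m\neq0$; and odd elements $E^i_m=K_{t^{m+1}\theta_i}$, $F^i_m=K_{t^m\,\partial(\theta_1\theta_2\theta_3\theta_4)/\partial\theta_i}$. Super skew-symmetric means $c(x,y)=-(-1)^{p(x)p(y)}c(y,x)$, where $p$ is parity; thus $c$ is skew on even elements and symmetric on odd ones. Only these bilinear values, not the bracket, are used in the claim. *)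

theory Defs
  imports Complex_Main "HOL-Library.Poly_Mapping" "HOL-Combinatorics.Permutations"
begin

section \<open>Generating functions\<close>

text \<open>
  An element of \<open>\<complex>[t\<^sup>-\<^sup>1, t, \<theta>\<^sub>1, \<dots>, \<theta>\<^sub>4]\<close> is a finitely supported coefficient function on the
  monomials \<open>t\<^sup>m \<theta>\<^sub>a\<^sub>1 \<dots> \<theta>\<^sub>a\<^sub>k\<close> with \<open>a\<^sub>1 < \<dots> < a\<^sub>k\<close>; such a monomial is encoded as the pair
  of \<open>m\<close> and \<open>{a\<^sub>1, \<dots>, a\<^sub>k}\<close>. The type admits odd variables \<open>\<theta>\<^sub>i\<close> for all \<open>i :: nat\<close>; the
  restriction to \<open>i \<in> {1..4}\<close> is made by \<open>kL\<close> below.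
\<close>

type_synonym monomial = "int \<times> nat set"
type_synonym genfun = "monomial \<Rightarrow>\<^sub>0 complex"

definition gscale :: "complex \<Rightarrow> genfun \<Rightarrow> genfun" (infixr "*g" 75) where
  "a *g f = Poly_Mapping.map ((*) a) f"

lemma lookup_gscale: "Poly_Mapping.lookup (a *g f) x = a * Poly_Mapping.lookup f x"
  by (simp add: gscale_def Poly_Mapping.map.rep_eq when_def)

interpretation genfun: vector_space gscale
  by standard (auto intro!: poly_mapping_eqI simp: lookup_gscale lookup_add algebra_simps)

text \<open>
  \<open>\<theta>\<^sub>A \<theta>\<^sub>B = \<plusminus> \<theta>\<^bsub>A \<union> B\<^esub>\<close>, the sign being that of the number of inversions, and \<open>0\<close> if \<open>A\<close> and \<open>B\<close>
  share a variable.
\<close>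
definition grassmann_sign :: "nat set \<Rightarrow> nat set \<Rightarrow> complex" where
  "grassmann_sign A B =
     (if A \<inter> B = {} then (- 1) ^ card {(a, b). a \<in> A \<and> b \<in> B \<and> b < a} else 0)"

definition gmult :: "genfun \<Rightarrow> genfun \<Rightarrow> genfun" (infixl "\<cdot>" 70) where
  "f \<cdot> g = (\<Sum>(m, A)\<in>Poly_Mapping.keys f. \<Sum>(n, B)\<in>Poly_Mapping.keys g.
     Poly_Mapping.single (m + n, A \<union> B)
       (grassmann_sign A B * Poly_Mapping.lookup f (m, A) * Poly_Mapping.lookup g (n, B)))"

text \<open>The left derivative \<open>\<partial>/\<partial>\<theta>\<^sub>i\<close>.\<close>
definition dtheta :: "nat \<Rightarrow> genfun \<Rightarrow> genfun" where
  "dtheta i f = (\<Sum>(m, A)\<in>{x \<in> Poly_Mapping.keys f. i \<in> snd x}.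
     Poly_Mapping.single (m, A - {i})
       ((- 1) ^ card {a \<in> A. a < i} * Poly_Mapping.lookup f (m, A)))"

definition tpow :: "int \<Rightarrow> genfun" where
  "tpow m = Poly_Mapping.single (m, {}) 1"

definition theta :: "nat \<Rightarrow> genfun" where
  "theta i = Poly_Mapping.single (0, {i}) 1"

definition theta1234 :: genfun where
  "theta1234 = theta 1 \<cdot> theta 2 \<cdot> theta 3 \<cdot> theta 4"


section \<open>The superspaces \<open>\<kk>\<^sup>L(1|4)\<close> and \<open>\<kk>\<^sup>L\<^sup>0(1|4)\<close>\<close>

text \<open>
  \<open>f \<mapsto> K\<^sub>f\<close> is an even linear isomorphism, and it is used here to identify a contact vector
  field \<open>K\<^sub>f\<close> with its generating function \<open>f\<close>. So \<open>kL\<close> and \<open>kL0\<close> are \<open>\<kk>\<^sup>L(1|4)\<close> and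
  \<open>\<kk>\<^sup>L\<^sup>0(1|4)\<close> as superspaces; the values of the form do not involve the bracket.
\<close>
definition kL :: "genfun set" where
  "kL = {f. \<forall>(m, A)\<in>Poly_Mapping.keys f. A \<subseteq> {1..4}}"

definition kL0 :: "genfun set" where
  "kL0 = {f \<in> kL. Poly_Mapping.lookup f (- 1, {1..4}) = 0}"

definition homogeneous :: "nat \<Rightarrow> genfun \<Rightarrow> bool" where
  "homogeneous p f \<longleftrightarrow> (\<forall>(m, A)\<in>Poly_Mapping.keys f. card A mod 2 = p)"

definition L :: "int \<Rightarrow> genfun" where
  "L m = tpow (m + 1)"

definition T :: "nat \<Rightarrow> nat \<Rightarrow> int \<Rightarrow> genfun" where
  "T i j m = tpow m \<cdot> theta i \<cdot> theta j"

text \<open>\<open>S 0\<close> is not in \<open>kL0\<close>; every use of \<open>S\<close> below is for a nonzero index, or has coefficient \<open>0\<close>.\<close>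
definition S :: "int \<Rightarrow> genfun" where
  "S m = tpow (m - 1) \<cdot> theta1234"

definition E :: "nat \<Rightarrow> int \<Rightarrow> genfun" where
  "E i m = tpow (m + 1) \<cdot> theta i"

definition F :: "nat \<Rightarrow> int \<Rightarrow> genfun" where
  "F i m = tpow m \<cdot> dtheta i theta1234"

datatype label = LL int | LT nat nat int | LS int | LE nat int | LF nat int

definition labels :: "label set" where
  "labels = range LL \<union> {LT i j m | i j m. 1 \<le> i \<and> i < j \<and> j \<le> 4} \<union> {LS m | m. m \<noteq> 0}
     \<union> {LE i m | i m. i \<in> {1..4}} \<union> {LF i m | i m. i \<in> {1..4}}"

text \<open>The family obtained from the natural one when \<open>L\<close> and \<open>E\<close> are replaced by \<open>L'\<close> and \<open>E'\<close>.\<close>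
fun family :: "(int \<Rightarrow> genfun) \<Rightarrow> (nat \<Rightarrow> int \<Rightarrow> genfun) \<Rightarrow> label \<Rightarrow> genfun" where
  "family L' E' (LL m) = L' m"
| "family L' E' (LT i j m) = T i j m"
| "family L' E' (LS m) = S m"
| "family L' E' (LE i m) = E' i m"
| "family L' E' (LF i m) = F i m"

definition kL0_basis :: "(label \<Rightarrow> genfun) \<Rightarrow> bool" where
  "kL0_basis b \<longleftrightarrow> inj_on b labels \<and> genfun.independent (b ` labels) \<and>
     genfun.span (b ` labels) = kL0"


section \<open>The form\<close>

definition super_skew_form :: "(genfun \<Rightarrow> genfun \<Rightarrow> complex) \<Rightarrow> bool" where
  "super_skew_form c \<longleftrightarrow>
     (\<forall>x\<in>kL0. \<forall>y\<in>kL0. \<forall>z\<in>kL0. c (x + y) z = c x z + c y z \<and> c z (x + y) = c z x + c z y) \<and>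
     (\<forall>a. \<forall>x\<in>kL0. \<forall>y\<in>kL0. c (a *g x) y = a * c x y \<and> c x (a *g y) = a * c x y) \<and>
     (\<forall>x\<in>kL0. \<forall>y\<in>kL0. \<forall>p q. homogeneous p x \<and> homogeneous q y \<longrightarrow>
        c x y = - ((- 1) ^ (p * q)) * c y x)"

text \<open>
  Pairs of basis elements, in one of the two orders, for which a possibly nonzero value of the form
  is listed. In the original basis the pairs \<open>L\<^sub>m, S\<^sub>n\<close> are listed as well.
\<close>
fun listed_tilde :: "label \<Rightarrow> label \<Rightarrow> bool" where
  "listed_tilde (LL _) (LL _) \<longleftrightarrow> True"
| "listed_tilde (LE i _) (LE j _) \<longleftrightarrow> i = j"
| "listed_tilde (LT i j _) (LT k l _) \<longleftrightarrow> {i, j} = {k, l} \<or> {i, j} \<inter> {k, l} = {}"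
| "listed_tilde (LF i _) (LF j _) \<longleftrightarrow> i = j"
| "listed_tilde (LS _) (LS _) \<longleftrightarrow> True"
| "listed_tilde (LE i _) (LF j _) \<longleftrightarrow> i = j"
| "listed_tilde _ _ \<longleftrightarrow> False"

fun listed :: "label \<Rightarrow> label \<Rightarrow> bool" where
  "listed (LL _) (LS _) \<longleftrightarrow> True"
| "listed x y \<longleftrightarrow> listed_tilde x y"

definition zero_unless ::
    "(label \<Rightarrow> label \<Rightarrow> bool) \<Rightarrow> (genfun \<Rightarrow> genfun \<Rightarrow> complex) \<Rightarrow> (label \<Rightarrow> genfun) \<Rightarrow> bool" where
  "zero_unless R c b \<longleftrightarrow>
     (\<forall>x\<in>labels. \<forall>y\<in>labels. \<not> R x y \<and> \<not> R y x \<longrightarrow> c (b x) (b y) = 0)"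

abbreviation delta :: "int \<Rightarrow> complex" where
  "delta k \<equiv> (if k = 0 then 1 else 0)"

definition three_parameter_form ::
    "complex \<Rightarrow> complex \<Rightarrow> complex \<Rightarrow> (genfun \<Rightarrow> genfun \<Rightarrow> complex) \<Rightarrow> bool" where
  "three_parameter_form \<alpha> \<beta> \<gamma> c \<longleftrightarrow>
     super_skew_form c \<and>
     (\<forall>m n. c (L m) (L n) = \<alpha> * of_int m * ((of_int m)\<^sup>2 - 1) * delta (m + n)) \<and>
     (\<forall>i\<in>{1..4}. \<forall>m n. c (E i m) (E i n) = \<alpha> * of_int m * (of_int m + 1) * delta (m + n + 1)) \<and>
     (\<forall>i\<in>{1..4}. \<forall>j\<in>{1..4}. \<forall>m n. i \<noteq> j \<longrightarrow>
        c (T i j m) (T i j n) = \<alpha> * of_int m * delta (m + n)) \<and>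
     (\<forall>i\<in>{1..4}. \<forall>m n. c (F i m) (F i n) = \<alpha> * delta (m + n + 1)) \<and>
     (\<forall>m n. m \<noteq> 0 \<and> n \<noteq> 0 \<longrightarrow> c (S m) (S n) = \<alpha> / of_int m * delta (m + n)) \<and>
     (\<forall>m n. n \<noteq> 0 \<longrightarrow> c (L m) (S n) = (\<gamma> + \<beta> * of_int m) * delta (m + n)) \<and>
     (\<forall>i\<in>{1..4}. \<forall>m n.
        c (E i m) (F i n) = (\<gamma> / 2 + \<beta> * (of_int m + 1 / 2)) * delta (m + n + 1)) \<and>
     (\<forall>p m n. p permutes {1..4} \<and> evenperm p \<longrightarrow>
        c (T (p 1) (p 2) m) (T (p 3) (p 4) n) = - \<beta> * of_int m * delta (m + n)) \<and>
     zero_unless listed c (family L E)"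


section \<open>The new basis\<close>

definition L_tilde :: "complex \<Rightarrow> complex \<Rightarrow> complex \<Rightarrow> int \<Rightarrow> genfun" where
  "L_tilde \<alpha> \<beta> \<gamma> m = L m + (- (\<beta> / \<alpha>) * (of_int m)\<^sup>2 - \<gamma> / \<alpha> * of_int m) *g S m"

definition E_tilde :: "complex \<Rightarrow> complex \<Rightarrow> complex \<Rightarrow> nat \<Rightarrow> int \<Rightarrow> genfun" where
  "E_tilde \<alpha> \<beta> \<gamma> i m =
     E i m + (\<beta> / (2 * \<alpha>) * (2 * of_int m + 1) + \<gamma> / (2 * \<alpha>)) *g F i m"

end

theory Submission
  imports Defs
begin

text \<open>
  Up to sign the natural basis consists of monomials, and the new family arises from it by a shear
  \<open>b\<^sub>l \<mapsto> b\<^sub>l + d\<^sub>l b\<^bsub>h l\<^esub>\<close> whose corrections \<open>b\<^bsub>h l\<^esub>\<close> are themselves left unchanged; so it is again a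
  basis. The values of the form then follow by bilinear expansion.
\<close>

section \<open>Sheared families of monomials\<close>

abbreviation mon :: "monomial \<Rightarrow> genfun" where
  "mon x \<equiv> Poly_Mapping.single x 1"

lemma lookup_mon: "Poly_Mapping.lookup (mon x) y = (if x = y then 1 else 0)"
  by (simp add: lookup_single when_def)

lemma gscale_mon: "a *g mon x = Poly_Mapping.single x a"
  by (rule poly_mapping_eqI) (simp add: lookup_gscale lookup_single when_def)

text \<open>Each \<open>Z\<close> plays the role of the kernel of a functional dual to
  \<open>b l\<close>. It contains the span of the other members but not \<open>b l\<close>, and
  since it cannot contain an equal member under another index, injectivity comes out too.\<close>

lemma injective_independentI:
  assumes "\<And>l. l \<in> I \<Longrightarrow> \<exists>Z. genfun.subspace Z \<and> b l \<notin> Z \<and> (\<forall>k\<in>I. k \<noteq> l \<longrightarrow> b k \<in> Z)"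
  shows "inj_on b I" and "genfun.independent (b ` I)"
proof -
  show inj: "inj_on b I"
    by (rule inj_onI) (metis assms)
  show "genfun.independent (b ` I)"
    unfolding genfun.dependent_def
  proof safe
    fix l assume l: "l \<in> I" and span: "b l \<in> genfun.span (b ` I - {b l})"
    obtain Z where Z: "genfun.subspace Z" "b l \<notin> Z" "\<forall>k\<in>I. k \<noteq> l \<longrightarrow> b k \<in> Z"
      using assms[OF l] by blast
    have "b ` I - {b l} \<subseteq> Z" using Z(3) by auto
    then show False using genfun.span_minimal[OF _ Z(1)] span Z(2) by blast
  qed
qed

text \<open>This is the kernel of the functional s z_p - d z_q; the separating subspaces below all
  have this shape.\<close>

lemma subspace_lookup_proportional:
  "genfun.subspace {z. s * Poly_Mapping.lookup z p = d * Poly_Mapping.lookup z q}"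
  by (auto simp: genfun.subspace_def lookup_add lookup_gscale algebra_simps)

text \<open>Targets of \<open>h\<close> are unsheared and each is hit at most once, so the
  coordinate matrix splits into triangular blocks of size at most two. The functional dual to
  \<open>b l\<close> is therefore, up to scaling, one coordinate or a combination of two.\<close>

lemma sheared_monomials_independent:
  assumes x: "inj_on x I"
    and s: "\<And>l. l \<in> I \<Longrightarrow> s l \<noteq> 0"
    and h: "\<And>l. l \<in> I \<Longrightarrow> d l \<noteq> 0 \<Longrightarrow> h l \<in> I \<and> d (h l) = 0"
    and h_inj: "inj_on h {l \<in> I. d l \<noteq> 0}"
    and b: "\<And>l. l \<in> I \<Longrightarrow> b l = s l *g mon (x l) + d l *g mon (x (h l))"
  shows "inj_on b I" and "genfun.independent (b ` I)"
proof -
  have coord: "Poly_Mapping.lookup (b l) (x k) =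
      (if l = k then s l else 0) + (if d l \<noteq> 0 \<and> h l = k then d l else 0)"
    if "l \<in> I" "k \<in> I" for l k
  proof (cases "d l = 0")
    case False
    then have "h l \<in> I" using h that by blast
    then show ?thesis
      using that False by (simp add: b lookup_add lookup_gscale lookup_mon inj_on_eq_iff[OF x])
  qed (use that in \<open>simp add: b lookup_add lookup_gscale lookup_mon inj_on_eq_iff[OF x]\<close>)
  have "\<exists>Z. genfun.subspace Z \<and> b l \<notin> Z \<and> (\<forall>k\<in>I. k \<noteq> l \<longrightarrow> b k \<in> Z)" if l: "l \<in> I" for l
  proof (cases "\<exists>g\<in>I. d g \<noteq> 0 \<and> h g = l")
    case True
    then obtain g where g: "g \<in> I" "d g \<noteq> 0" "h g = l" by blast
    have dl: "d l = 0" using h[OF g(1,2)] g(3) by simp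
    then have "g \<noteq> l" using g(2) by blast
    \<comment> \<open>\<open>b g\<close> also has a component at \<open>x l\<close>, so the functional dual to \<open>b l\<close> must subtract it.\<close>
    let ?Z = "{z. s g * Poly_Mapping.lookup z (x l) = d g * Poly_Mapping.lookup z (x g)}"
    have "b l \<notin> ?Z"
      using coord[OF l l] coord[OF l g(1)] s[OF g(1)] s[OF l] dl \<open>g \<noteq> l\<close> by simp
    moreover have "b k \<in> ?Z" if k: "k \<in> I" "k \<noteq> l" for k
    proof (cases "k = g")
      case True
      then show ?thesis
        using coord[OF g(1) l] coord[OF g(1,1)] g dl \<open>g \<noteq> l\<close> by simp
    next
      case False
      \<comment> \<open>By injectivity only \<open>g\<close> is sheared into \<open>l\<close>.
        Nothing is sheared into \<open>g\<close>, because targets have \<open>d\<close> equal to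
        zero.\<close>
      then have "d k = 0 \<or> h k \<noteq> l"
        using inj_onD[OF h_inj, of k g] k(1) g by auto
      moreover have "d k = 0 \<or> h k \<noteq> g"
        using h[OF k(1)] g(2) by blast
      ultimately have "Poly_Mapping.lookup (b k) (x l) = 0" "Poly_Mapping.lookup (b k) (x g) = 0"
        using coord[OF k(1) l] coord[OF k(1) g(1)] k(2) False by auto
      then show ?thesis by simp
    qed
    ultimately show ?thesis
      by (intro exI[of _ ?Z] conjI ballI impI subspace_lookup_proportional)
  next
    case False
    \<comment> \<open>No other member has a component at \<open>x l\<close>, so the plain coordinate
      hyperplane separates; the factors 1 and 0 only fit it to the common shape.\<close>
    let ?Z = "{z. 1 * Poly_Mapping.lookup z (x l) = 0 * Poly_Mapping.lookup z (x l)}"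
    have unhit: "\<not> (d k \<noteq> 0 \<and> h k = l)" if "k \<in> I" for k
      using False that by blast
    have "b l \<notin> ?Z" using coord[OF l l] unhit[OF l] s[OF l] by simp
    moreover have "b k \<in> ?Z" if k: "k \<in> I" "k \<noteq> l" for k
      using coord[OF k(1) l] unhit[OF k(1)] k(2) by simp
    ultimately show ?thesis
      by (intro exI[of _ ?Z] conjI ballI impI subspace_lookup_proportional)
  qed
  note separated = this
  show "inj_on b I" by (rule injective_independentI(1)[OF separated])
  show "genfun.independent (b ` I)" by (rule injective_independentI(2)[OF separated])
qed

section \<open>The span of a sheared family\<close>

lemma subspace_keys: "genfun.subspace {f. Poly_Mapping.keys f \<subseteq> X}"
proof -
  have iff: "Poly_Mapping.keys f \<subseteq> X \<longleftrightarrow> (\<forall>y. y \<notin> X \<longrightarrow> Poly_Mapping.lookup f y = 0)" for f :: genfun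
    by (auto simp: in_keys_iff)
  show ?thesis
    unfolding genfun.subspace_def iff by (auto simp: lookup_add lookup_gscale)
qed

lemma genfun_sum_monomials:
  "f = (\<Sum>x\<in>Poly_Mapping.keys f. Poly_Mapping.lookup f x *g mon x)"
  by (rule poly_mapping_eqI)
    (simp add: lookup_sum lookup_gscale lookup_mon in_keys_iff sum.delta' if_distrib cong: if_cong)

text \<open>The shear can be undone in two rounds: unsheared members give their monomials by
  rescaling, and these include all corrections, which can then be subtracted from the sheared
  members.\<close>

lemma sheared_monomials_span:
  assumes s: "\<And>l. l \<in> I \<Longrightarrow> s l \<noteq> 0"
    and h: "\<And>l. l \<in> I \<Longrightarrow> d l \<noteq> 0 \<Longrightarrow> h l \<in> I \<and> d (h l) = 0"
    and b: "\<And>l. l \<in> I \<Longrightarrow> b l = s l *g mon (x l) + d l *g mon (x (h l))"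
  shows "genfun.span (b ` I) = {f. Poly_Mapping.keys f \<subseteq> x ` I}" (is "?span = ?K")
proof
  have "b l \<in> ?K" if l: "l \<in> I" for l
  proof -
    have mon: "mon (x k) \<in> ?K" if "k \<in> I" for k using that by simp
    have "d l *g mon (x (h l)) \<in> ?K"
    \<comment> \<open>Only a nonzero \<open>d l\<close> guarantees that \<open>h l\<close> lies in
      \<open>I\<close>; otherwise the correction is zero anyway.\<close>
    proof (cases "d l = 0")
      case True
      then show ?thesis by simp
    next
      case False
      then show ?thesis
        using genfun.subspace_scale[OF subspace_keys mon] h l by blast
    qed
    then show ?thesis
      unfolding b[OF l] using genfun.subspace_add[OF subspace_keys]
        genfun.subspace_scale[OF subspace_keys mon[OF l]] by blast
  qed
  then show "?span \<subseteq> ?K"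
    by (intro genfun.span_minimal subspace_keys) auto
next
  have fixed: "mon (x l) \<in> ?span" if l: "l \<in> I" "d l = 0" for l
  proof -
    have "mon (x l) = inverse (s l) *g b l"
      using l s by (simp add: b)
    then show ?thesis using l by (simp add: genfun.span_scale genfun.span_base)
  qed
  have mon: "mon (x l) \<in> ?span" if l: "l \<in> I" for l
  proof (cases "d l = 0")
    case False
    then have "mon (x (h l)) \<in> ?span" using fixed h l by blast
    moreover have "mon (x l) = inverse (s l) *g (b l - d l *g mon (x (h l)))"
      using l s by (simp add: b)
    moreover have "b l \<in> ?span" using l by (simp add: genfun.span_base)
    ultimately show ?thesis
      by (metis genfun.span_scale genfun.span_diff)
  qed (use fixed l in blast)
  show "?K \<subseteq> ?span"
  proof
    fix f assume f: "f \<in> ?K"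
    have "(\<Sum>y\<in>Poly_Mapping.keys f. Poly_Mapping.lookup f y *g mon y) \<in> ?span"
      using f mon by (intro genfun.span_sum genfun.span_scale) auto
    then show "f \<in> ?span"
      by (simp flip: genfun_sum_monomials)
  qed
qed


section \<open>The natural basis\<close>

lemma mon_mult: "mon (m, A) \<cdot> mon (n, B) = grassmann_sign A B *g mon (m + n, A \<union> B)"
  by (simp add: gmult_def gscale_mon)

lemma grassmann_sign_ordered:
  assumes "\<forall>a\<in>A. \<forall>b\<in>B. a < b"
  shows "grassmann_sign A B = 1"
proof -
  have disjoint: "A \<inter> B = {}" using assms by blast
  have no_inversion: "{(a, b). a \<in> A \<and> b \<in> B \<and> b < a} = {}"
    using assms by (auto dest: less_asym)
  show ?thesis by (simp only: grassmann_sign_def disjoint no_inversion) simp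
qed

lemma mon_mult_ordered:
  "\<forall>a\<in>A. \<forall>b\<in>B. a < b \<Longrightarrow> mon (m, A) \<cdot> mon (n, B) = mon (m + n, A \<union> B)"
  by (simp add: mon_mult grassmann_sign_ordered)

lemma theta1234_mon: "theta1234 = mon (0, {1..4})"
proof -
  have "{4, 3, 2, 1} = {1..4::nat}" by auto
  then show ?thesis
    by (simp add: theta1234_def theta_def mon_mult_ordered)
qed

text \<open>For \<open>i\<close> in 1..4 the exponent is i - 1, the number of odd variables that
  theta_i passes on its way to the front of the product.\<close>

definition F_sign :: "nat \<Rightarrow> complex" where
  "F_sign i = (- 1) ^ card {a \<in> {1..4}. a < i}"

lemma F_sign_nonzero: "F_sign i \<noteq> 0"
  by (simp add: F_sign_def)

lemma dtheta_theta1234: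
  assumes "i \<in> {1..4}"
  shows "dtheta i theta1234 = F_sign i *g mon (0, {1..4} - {i})"
proof -
  have "{x \<in> Poly_Mapping.keys theta1234. i \<in> snd x} = {(0, {1..4})}"
    using assms by (auto simp: theta1234_mon)
  then show ?thesis
    by (simp add: dtheta_def theta1234_mon F_sign_def gscale_mon)
qed

lemma tpow_mult_single: "tpow m \<cdot> Poly_Mapping.single (n, A) a = Poly_Mapping.single (m + n, A) a"
  by (cases "a = 0") (simp_all add: tpow_def gmult_def grassmann_sign_ordered)

lemma L_mon: "L m = mon (m + 1, {})"
  by (simp add: L_def tpow_def)

lemma T_mon: "i < j \<Longrightarrow> T i j m = mon (m, {i, j})"
  by (simp add: T_def theta_def tpow_mult_single mon_mult_ordered insert_commute)

lemma S_mon: "S m = mon (m - 1, {1..4})"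
  by (simp add: S_def theta1234_mon tpow_mult_single)

lemma E_mon: "E i m = mon (m + 1, {i})"
  by (simp add: E_def theta_def tpow_mult_single)

lemma F_mon: "i \<in> {1..4} \<Longrightarrow> F i m = F_sign i *g mon (m, {1..4} - {i})"
  by (simp add: F_def dtheta_theta1234 gscale_mon tpow_mult_single)

text \<open>Correct up to \<open>label_sign\<close> for actual labels only: with i > j,
  \<open>T i j m\<close> would carry a further minus sign.\<close>

fun label_monomial :: "label \<Rightarrow> monomial" where
  "label_monomial (LL m) = (m + 1, {})"
| "label_monomial (LT i j m) = (m, {i, j})"
| "label_monomial (LS m) = (m - 1, {1..4})"
| "label_monomial (LE i m) = (m + 1, {i})"
| "label_monomial (LF i m) = (m, {1..4} - {i})"

fun label_sign :: "label \<Rightarrow> complex" where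
  "label_sign (LF i m) = F_sign i"
| "label_sign _ = 1"

lemma label_sign_nonzero: "label_sign l \<noteq> 0"
  by (cases l) (simp_all add: F_sign_nonzero)

section \<open>Labels against monomials\<close>

lemma in_labels_simps [simp]:
  "LL m \<in> labels"
  "LT i j m \<in> labels \<longleftrightarrow> 1 \<le> i \<and> i < j \<and> j \<le> 4"
  "LS m \<in> labels \<longleftrightarrow> m \<noteq> 0"
  "LE i m \<in> labels \<longleftrightarrow> i \<in> {1..4}"
  "LF i m \<in> labels \<longleftrightarrow> i \<in> {1..4}"
  by (auto simp: labels_def)

lemma family_mon: "l \<in> labels \<Longrightarrow> family L E l = label_sign l *g mon (label_monomial l)"
  by (cases l) (simp_all add: L_mon T_mon S_mon E_mon F_mon)

text \<open>The number of odd variables is 0, 2, 4, 1, 3 for the five kinds of label, so it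
  determines the kind; the indices are then read off from the exponent and the set.\<close>

lemma inj_on_label_monomial: "inj_on label_monomial labels"
proof (rule inj_onI)
  fix k l assume kl: "k \<in> labels" "l \<in> labels" "label_monomial k = label_monomial l"
  have card: "card (snd (label_monomial l)) =
      (case l of LL _ \<Rightarrow> 0 | LT _ _ _ \<Rightarrow> 2 | LS _ \<Rightarrow> 4 | LE _ _ \<Rightarrow> 1 | LF _ _ \<Rightarrow> 3)"
    if "l \<in> labels" for l
    using that by (cases l) simp_all
  have eq: "(case k of LL _ \<Rightarrow> 0 | LT _ _ _ \<Rightarrow> 2 | LS _ \<Rightarrow> 4 | LE _ _ \<Rightarrow> 1 | LF _ _ \<Rightarrow> 3) =
      (case l of LL _ \<Rightarrow> 0 | LT _ _ _ \<Rightarrow> 2 | LS _ \<Rightarrow> 4 | LE _ _ \<Rightarrow> 1 | LF _ _ \<Rightarrow> (3::nat))"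
    using card[OF kl(1)] card[OF kl(2)] kl(3) by simp
  show "k = l"
  proof (cases k)
    case (LL m)
    with eq obtain n where "l = LL n" by (cases l) simp_all
    with LL kl(3) show ?thesis by simp
  next
    case k: (LT i j m)
    with eq obtain i' j' n where l: "l = LT i' j' n" by (cases l) simp_all
    have "{i, j} = {i', j'}" "i < j" "i' < j'" using kl k l by simp_all
    then have "i = i' \<and> j = j'" by (metis doubleton_eq_iff less_asym)
    with k l kl(3) show ?thesis by simp
  next
    case (LS m)
    with eq obtain n where "l = LS n" by (cases l) simp_all
    with LS kl(3) show ?thesis by simp
  next
    case (LE i m)
    with eq obtain j n where "l = LE j n" by (cases l) simp_all
    with LE kl(3) show ?thesis by simp
  next
    case k: (LF i m)
    with eq obtain j n where l: "l = LF j n" by (cases l) simp_all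
    have "{1..4} - {i} = {1..4} - {j}" "i \<in> {1..4}" using kl k l by simp_all
    then have "i = j" by blast
    with k l kl(3) show ?thesis by simp
  qed
qed

text \<open>The one monomial left out would belong to \<open>LS 0\<close>, which is not a label.
  Every other one is reached by a label chosen according to the size of \<open>A\<close>.\<close>

lemma label_monomial_image:
  "label_monomial ` labels = {(m, A). A \<subseteq> {1..4} \<and> (m, A) \<noteq> (- 1, {1..4})}" (is "_ = ?M")
proof
  have "label_monomial l \<in> ?M" if l: "l \<in> labels" for l
  proof (cases l)
    case (LT i j m)
    then have "card {i, j} \<noteq> card {1..4::nat}" using l by simp
    then have "{i, j} \<noteq> {1..4}" by metis
    then show ?thesis using l LT by simp
  next
    case (LE i m)
    have "card {i} \<noteq> card {1..4::nat}" by simp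
    then have "{i} \<noteq> {1..4}" by metis
    then show ?thesis using l LE by simp
  next
    case (LF i m)
    then have "i \<in> {1..4} - ({1..4} - {i})" using l by simp
    then have "{1..4} - {i} \<noteq> {1..4}" by blast
    then show ?thesis using LF by simp
  qed (use l in simp_all)
  then show "label_monomial ` labels \<subseteq> ?M" by (rule image_subsetI)
next
  show "?M \<subseteq> label_monomial ` labels"
  proof (rule subrelI, rule ccontr)
    fix m A
    assume mA: "(m, A) \<in> ?M" and ne: "(m, A) \<notin> label_monomial ` labels"
    then have A: "A \<subseteq> {1..4}" by simp
    have mem: "label_monomial l \<noteq> (m, A)" if "l \<in> labels" for l
      using ne that by (metis image_eqI)
    have "A = {1..4}"
    proof (rule ccontr)
      assume "A \<noteq> {1..4}"
      then have "card A < 4" using psubset_card_mono[of "{1..4}" A] A by auto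
      then consider "card A = 0" | "card A = 1" | "card A = 2" | "card A = 3" by linarith
      then show False
      proof cases
        case 1
        then have "A = {}" using finite_subset[OF A] by simp
        then show False using mem[of "LL (m - 1)"] by simp
      next
        case 2
        then obtain i where "A = {i}" by (rule card_1_singletonE)
        then show False using mem[of "LE i (m - 1)"] A by simp
      next
        case 3
        then obtain i j where "A = {i, j}" "i < j"
          by (metis card_2_iff insert_commute linorder_neqE_nat)
        then show False using mem[of "LT i j m"] A by simp
      next
        case 4
        then have "card ({1..4} - A) = 1" using A by (simp add: card_Diff_subset finite_subset)
        then obtain i where i: "{1..4} - A = {i}" by (rule card_1_singletonE)
        then have "A = {1..4} - {i}" "i \<in> {1..4}" using A by blast+
        then show False using mem[of "LF i m"] by simp
      qed
    qed
    \<comment> \<open>With \<open>A\<close> full, the excluded pair rules out m = -1, so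
      \<open>LS (m + 1)\<close> is a label.\<close>
    then show False using mA mem[of "LS (m + 1)"] by simp
  qed
qed

text \<open>Both conditions defining \<open>kL0\<close> only forbid certain keys, so it is a
  coordinate subspace of the form produced by the span lemma.\<close>

lemma kL0_eq: "kL0 = {f. Poly_Mapping.keys f \<subseteq> label_monomial ` labels}"
proof -
  have "f \<in> kL0 \<longleftrightarrow> Poly_Mapping.keys f \<subseteq> label_monomial ` labels" for f
    unfolding kL0_def kL_def label_monomial_image
    by (auto simp: in_keys_iff)
  then show ?thesis by blast
qed

lemma subspace_kL0: "genfun.subspace kL0"
  unfolding kL0_eq by (rule subspace_keys)

lemma family_in_kL0: "l \<in> labels \<Longrightarrow> family L E l \<in> kL0"
  by (simp add: family_mon kL0_eq gscale_mon)

fun parity :: "label \<Rightarrow> nat" where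
  "parity (LE i m) = 1"
| "parity (LF i m) = 1"
| "parity _ = 0"

lemma homogeneous_family: "l \<in> labels \<Longrightarrow> homogeneous (parity l) (family L E l)"
  by (cases l) (simp_all add: family_mon homogeneous_def gscale_mon F_sign_nonzero del: family.simps)


section \<open>The shear\<close>

text \<open>The target of the shear. The default \<open>partner l = l\<close> is a placeholder,
  since \<open>shear\<close> vanishes there; it also vanishes at \<open>LL 0\<close>, whose partner
  \<open>LS 0\<close> is not a label.\<close>

fun partner :: "label \<Rightarrow> label" where
  "partner (LL m) = LS m"
| "partner (LE i m) = LF i m"
| "partner l = l"

fun shear :: "complex \<Rightarrow> complex \<Rightarrow> complex \<Rightarrow> label \<Rightarrow> complex" where
  "shear \<alpha> \<beta> \<gamma> (LL m) = - (\<beta> / \<alpha>) * (of_int m)\<^sup>2 - \<gamma> / \<alpha> * of_int m"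
| "shear \<alpha> \<beta> \<gamma> (LE i m) = \<beta> / (2 * \<alpha>) * (2 * of_int m + 1) + \<gamma> / (2 * \<alpha>)"
| "shear \<alpha> \<beta> \<gamma> _ = 0"

lemma family_tilde:
  "family (L_tilde \<alpha> \<beta> \<gamma>) (E_tilde \<alpha> \<beta> \<gamma>) l =
    family L E l + shear \<alpha> \<beta> \<gamma> l *g family L E (partner l)"
  by (cases l) (simp_all add: L_tilde_def E_tilde_def)

text \<open>The coefficient a_m is divisible by m, so if it is nonzero then \<open>LS m\<close> is a
  label. Partners reached with nonzero coefficient are of kind S or F, which are not
  sheared.\<close>

lemma shear_partner:
  assumes "l \<in> labels" "shear \<alpha> \<beta> \<gamma> l \<noteq> 0"
  shows "partner l \<in> labels" and "shear \<alpha> \<beta> \<gamma> (partner l) = 0"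
  using assms by (cases l; auto)+

lemma kL0_basis_tilde: "kL0_basis (family (L_tilde \<alpha> \<beta> \<gamma>) (E_tilde \<alpha> \<beta> \<gamma>))"
proof -
  \<comment> \<open>The correction is a multiple of a basis element; the extra sign turns it into a
    multiple of that element's monomial.\<close>
  let ?d = "\<lambda>l. shear \<alpha> \<beta> \<gamma> l * label_sign (partner l)"
  have b: "family (L_tilde \<alpha> \<beta> \<gamma>) (E_tilde \<alpha> \<beta> \<gamma>) l =
      label_sign l *g mon (label_monomial l) + ?d l *g mon (label_monomial (partner l))"
    if l: "l \<in> labels" for l
    using shear_partner(1)[OF l]
    by (cases "shear \<alpha> \<beta> \<gamma> l = 0") (simp_all add: family_tilde family_mon l)
  have h: "partner l \<in> labels \<and> ?d (partner l) = 0" if "l \<in> labels" "?d l \<noteq> 0" for l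
    using shear_partner[OF that(1)] that(2) by auto
  have h_inj: "inj_on partner {l \<in> labels. ?d l \<noteq> 0}"
  proof (rule inj_onI, clarify)
    fix k l assume "partner k = partner l" "?d k \<noteq> 0" "?d l \<noteq> 0"
    then show "k = l" by (cases k; cases l) auto
  qed
  show ?thesis
    unfolding kL0_basis_def kL0_eq
    using sheared_monomials_independent[OF inj_on_label_monomial label_sign_nonzero h h_inj b]
      sheared_monomials_span[OF label_sign_nonzero h b]
    by blast
qed


section \<open>Values of the form\<close>

lemma form_add:
  assumes "super_skew_form c" "x \<in> kL0" "y \<in> kL0" "z \<in> kL0"
  shows "c (x + y) z = c x z + c y z" and "c z (x + y) = c z x + c z y"
proof -
  note bilinear = assms(1)[unfolded super_skew_form_def, THEN conjunct1, rule_format, OF assms(2-4)]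
  show "c (x + y) z = c x z + c y z" "c z (x + y) = c z x + c z y"
    by (rule bilinear[THEN conjunct1], rule bilinear[THEN conjunct2])
qed

lemma form_scale:
  assumes "super_skew_form c" "x \<in> kL0" "y \<in> kL0"
  shows "c (a *g x) y = a * c x y" and "c x (a *g y) = a * c x y"
proof -
  note bilinear = assms(1)[unfolded super_skew_form_def, THEN conjunct2, THEN conjunct1,
      rule_format, OF assms(2,3)]
  show "c (a *g x) y = a * c x y" "c x (a *g y) = a * c x y"
    by (rule bilinear[THEN conjunct1], rule bilinear[THEN conjunct2])
qed

lemma form_skew:
  assumes "super_skew_form c" "x \<in> kL0" "y \<in> kL0" "homogeneous p x" "homogeneous q y"
  shows "c x y = - ((- 1) ^ (p * q)) * c y x"
  by (rule assms(1)[unfolded super_skew_form_def, THEN conjunct2, THEN conjunct2, rule_format,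
      OF assms(2,3) conjI[OF assms(4,5)]])

lemma skew_family:
  assumes "super_skew_form c" "k \<in> labels" "l \<in> labels"
  shows "c (family L E k) (family L E l) =
    - ((- 1) ^ (parity k * parity l)) * c (family L E l) (family L E k)"
  by (intro form_skew assms family_in_kL0 homogeneous_family)

text \<open>Outside \<open>kL0\<close> nothing is known about \<open>c\<close>. Asking for
  \<open>x'\<close> in \<open>kL0\<close> only when \<open>a\<close> is nonzero admits the new L_0,
  whose formal correction is 0 times \<open>S 0\<close>.\<close>

lemma form_add_scale:
  assumes c: "super_skew_form c" and kL0: "x \<in> kL0" "y \<in> kL0" and x': "a \<noteq> 0 \<Longrightarrow> x' \<in> kL0"
  shows "c (x + a *g x') y = c x y + a * c x' y" and "c y (x + a *g x') = c y x + a * c y x'"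
proof -
  have "c (x + a *g x') y = c x y + a * c x' y \<and> c y (x + a *g x') = c y x + a * c y x'"
  proof (cases "a = 0")
    case False
    then have "x' \<in> kL0" by (rule x')
    moreover from this have "a *g x' \<in> kL0" by (rule genfun.subspace_scale[OF subspace_kL0])
    ultimately show ?thesis using kL0 by (simp add: form_add[OF c] form_scale[OF c])
  qed simp
  then show "c (x + a *g x') y = c x y + a * c x' y" "c y (x + a *g x') = c y x + a * c y x'"
    by simp_all
qed

lemma form_shear:
  assumes c: "super_skew_form c" and kL0: "x \<in> kL0" "y \<in> kL0"
    and x': "a \<noteq> 0 \<Longrightarrow> x' \<in> kL0" and y': "b \<noteq> 0 \<Longrightarrow> y' \<in> kL0"
  shows "c (x + a *g x') (y + b *g y') = c x y + b * c x y' + a * c x' y + a * b * c x' y'"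
proof -
  have "y + b *g y' \<in> kL0"
    using kL0(2) y' genfun.subspace_add[OF subspace_kL0] genfun.subspace_scale[OF subspace_kL0]
    by (cases "b = 0") simp_all
  then have "c (x + a *g x') (y + b *g y') = c x (y + b *g y') + a * c x' (y + b *g y')"
    using form_add_scale(1)[OF c kL0(1) _ x'] by blast
  also have "c x (y + b *g y') = c x y + b * c x y'"
    using form_add_scale(2)[OF c kL0(2,1) y'] by blast
  also have "a * c x' (y + b *g y') = a * (c x' y + b * c x' y')"
  proof (cases "a = 0")
    case False
    then show ?thesis using form_add_scale(2)[OF c kL0(2) x'[OF False] y'] by simp
  qed simp
  finally show ?thesis by (simp add: algebra_simps)
qed

lemma form_family_tilde:
  fixes \<alpha> \<beta> \<gamma> :: complex
  defines "b \<equiv> family L E" and "bt \<equiv> family (L_tilde \<alpha> \<beta> \<gamma>) (E_tilde \<alpha> \<beta> \<gamma>)"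
    and "d \<equiv> shear \<alpha> \<beta> \<gamma>"
  assumes c: "super_skew_form c" and kl: "k \<in> labels" "l \<in> labels"
  shows "c (bt k) (bt l) = c (b k) (b l) + d l * c (b k) (b (partner l))
    + d k * c (b (partner k)) (b l) + d k * d l * c (b (partner k)) (b (partner l))"
  unfolding b_def bt_def d_def family_tilde
  by (rule form_shear[OF c family_in_kL0 family_in_kL0 family_in_kL0 family_in_kL0])
    (simp_all only: kl shear_partner(1))

text \<open>Up to order, \<open>listed\<close> relates all L with all S and all E with all F of the
  same upper index. Passing to a partner stays within such a class, so unrelated labels stay
  unrelated.\<close>

lemma unlisted_partner:
  assumes "\<not> listed k l" "\<not> listed l k" "\<not> listed_tilde k l" "\<not> listed_tilde l k"
  shows "\<not> listed k (partner l)" "\<not> listed (partner l) k"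
    "\<not> listed (partner k) (partner l)"
  using assms by (cases k; cases l; simp)+

theorem mainTheorem4:
  fixes \<alpha> \<beta> \<gamma> :: complex and c :: "genfun \<Rightarrow> genfun \<Rightarrow> complex"
    and Lt :: "int \<Rightarrow> genfun" and Et :: "nat \<Rightarrow> int \<Rightarrow> genfun"
  assumes "\<alpha> \<noteq> 0"
    and "three_parameter_form \<alpha> \<beta> \<gamma> c"
  defines "Lt \<equiv> L_tilde \<alpha> \<beta> \<gamma>" and "Et \<equiv> E_tilde \<alpha> \<beta> \<gamma>"
  shows "kL0_basis (family Lt Et) \<and>
    Lt 0 = L 0 \<and>
    (\<forall>m n. c (Lt m) (Lt n) =
       ((\<alpha>\<^sup>2 - \<beta>\<^sup>2) / \<alpha> * of_int m ^ 3 - (\<alpha>\<^sup>2 - \<gamma>\<^sup>2) / \<alpha> * of_int m) * delta (m + n)) \<and>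
    (\<forall>i\<in>{1..4}. \<forall>m n. c (Et i m) (Et i n) =
       ((\<alpha>\<^sup>2 - 3 * \<beta>\<^sup>2) / \<alpha> * (of_int m + 1 / 2)\<^sup>2 - (\<alpha>\<^sup>2 - 3 * \<gamma>\<^sup>2) / (4 * \<alpha>)) * delta (m + n + 1)) \<and>
    (\<forall>i\<in>{1..4}. \<forall>j\<in>{1..4}. \<forall>m n. i \<noteq> j \<longrightarrow>
       c (T i j m) (T i j n) = \<alpha> * of_int m * delta (m + n)) \<and>
    (\<forall>i\<in>{1..4}. \<forall>m n. c (F i m) (F i n) = \<alpha> * delta (m + n + 1)) \<and>
    (\<forall>m n. m \<noteq> 0 \<and> n \<noteq> 0 \<longrightarrow> c (S m) (S n) = \<alpha> / of_int m * delta (m + n)) \<and>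
    (\<forall>i\<in>{1..4}. \<forall>m n.
       c (Et i m) (F i n) = (\<gamma> + \<beta> * (2 * of_int m + 1)) * delta (m + n + 1)) \<and>
    (\<forall>p m n. p permutes {1..4} \<and> evenperm p \<longrightarrow>
       c (T (p 1) (p 2) m) (T (p 3) (p 4) n) = - \<beta> * of_int m * delta (m + n)) \<and>
    zero_unless listed_tilde c (family Lt Et) \<and>
    (\<forall>m n. n \<noteq> 0 \<longrightarrow> c (Lt m) (S n) = 0)"
proof -

  \<comment> \<open>The given values, also in reversed order\<close>
  from assms(2) have c: "super_skew_form c"
    and LL: "\<forall>m n. c (L m) (L n) = \<alpha> * of_int m * ((of_int m)\<^sup>2 - 1) * delta (m + n)"
    and EE: "\<forall>i\<in>{1..4}. \<forall>m n.
      c (E i m) (E i n) = \<alpha> * of_int m * (of_int m + 1) * delta (m + n + 1)"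
    and TT: "\<forall>i\<in>{1..4}. \<forall>j\<in>{1..4}. \<forall>m n. i \<noteq> j \<longrightarrow>
      c (T i j m) (T i j n) = \<alpha> * of_int m * delta (m + n)"
    and FF: "\<forall>i\<in>{1..4}. \<forall>m n. c (F i m) (F i n) = \<alpha> * delta (m + n + 1)"
    and SS: "\<forall>m n. m \<noteq> 0 \<and> n \<noteq> 0 \<longrightarrow> c (S m) (S n) = \<alpha> / of_int m * delta (m + n)"
    and LS: "\<forall>m n. n \<noteq> 0 \<longrightarrow> c (L m) (S n) = (\<gamma> + \<beta> * of_int m) * delta (m + n)"
    and EF: "\<forall>i\<in>{1..4}. \<forall>m n.
      c (E i m) (F i n) = (\<gamma> / 2 + \<beta> * (of_int m + 1 / 2)) * delta (m + n + 1)"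
    and TT_even: "\<forall>p m n. p permutes {1..4} \<and> evenperm p \<longrightarrow>
      c (T (p 1) (p 2) m) (T (p 3) (p 4) n) = - \<beta> * of_int m * delta (m + n)"
    and zero: "zero_unless listed c (family L E)"
    unfolding three_parameter_form_def by - (elim conjE, assumption)+
  note LL = LL[rule_format] and EE = EE[rule_format] and LS = LS[rule_format]
    and EF = EF[rule_format]
  \<comment> \<open>Reversal changes the sign for the even pair here and keeps it for the odd pair
    in \<open>FE\<close>.\<close>
  have SL: "c (S n) (L m) = - ((\<gamma> + \<beta> * of_int m) * delta (m + n))" if "n \<noteq> 0" for m n
    using skew_family[OF c, of "LS n" "LL m"] LS[OF that, of m] that by simp
  have FE: "c (F i n) (E i m) = (\<gamma> / 2 + \<beta> * (of_int m + 1 / 2)) * delta (m + n + 1)"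
    if "i \<in> {1..4}" for i m n
    using skew_family[OF c, of "LF i n" "LE i m"] EF[OF that, of m n] that by simp
  note expand = form_family_tilde[OF c, of _ _ \<alpha> \<beta> \<gamma>, folded Lt_def Et_def]

  \<comment> \<open>Values in the new basis\<close>
  have Lt0: "Lt 0 = L 0"
    by (simp add: Lt_def L_tilde_def)
  have LtLt: "c (Lt m) (Lt n) =
      ((\<alpha>\<^sup>2 - \<beta>\<^sup>2) / \<alpha> * of_int m ^ 3 - (\<alpha>\<^sup>2 - \<gamma>\<^sup>2) / \<alpha> * of_int m) * delta (m + n)" for m n
  \<comment> \<open>No values at \<open>S 0\<close> are prescribed, so a zero index is treated
    apart; its shear coefficient is 0.\<close>
  proof (cases "m = 0 \<or> n = 0")
    case True
    then show ?thesis
      using expand[of "LL m" "LL n"] LL[of m n] LS[of n m] SL[of m n] by (cases "m + n = 0") auto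
  next
    case False
    show ?thesis
    proof (cases "m + n = 0")
      case True
      then have n: "n = - m" by simp
      define x :: complex where "x = of_int m"
      \<comment> \<open>Put D = (\<beta>^2 x^3 - \<gamma>^2 x) / \<alpha>. The two mixed terms add
        up to -2D, their \<beta>\<gamma> parts cancelling, and the S-S term is D; the net correction
        is -D.\<close>
      have "c (Lt m) (Lt n) = \<alpha> * x * (x\<^sup>2 - 1)
          + (- (\<beta> / \<alpha>) * x\<^sup>2 + \<gamma> / \<alpha> * x) * (\<gamma> + \<beta> * x)
          + (- (\<beta> / \<alpha>) * x\<^sup>2 - \<gamma> / \<alpha> * x) * (\<beta> * x - \<gamma>)
          + (- (\<beta> / \<alpha>) * x\<^sup>2 - \<gamma> / \<alpha> * x) * (- (\<beta> / \<alpha>) * x\<^sup>2 + \<gamma> / \<alpha> * x) * (\<alpha> / x)"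
        using expand[of "LL m" "LL n"] False unfolding n x_def by (simp add: LL LS SL SS)
      also have "\<dots> = (\<alpha>\<^sup>2 - \<beta>\<^sup>2) / \<alpha> * x ^ 3 - (\<alpha>\<^sup>2 - \<gamma>\<^sup>2) / \<alpha> * x"
      proof -
        have "x \<noteq> 0" using False by (simp add: x_def)
        then show ?thesis
          using assms(1) by (simp add: field_simps power2_eq_square power3_eq_cube)
      qed
      finally show ?thesis by (simp add: n x_def)
    next
      case nz: False
      then have "n + m \<noteq> 0" by simp
      then show ?thesis
        using expand[of "LL m" "LL n"] False nz by (simp add: LL LS SL SS)
    qed
  qed
  \<comment> \<open>This is the equation that fixes a_m: for n = -m it reads \<gamma> + \<beta> m +
    a_m \<alpha> / m = 0.\<close>
  have LtS: "c (Lt m) (S n) = 0" if n: "n \<noteq> 0" for m n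
  proof (cases "m + n = 0")
    case True
    then have "n = - m" by simp
    then show ?thesis
      using expand[of "LL m" "LS n"] n assms(1)
      by (simp add: LS SS field_simps power2_eq_square)
  next
    case False
    then show ?thesis
      using expand[of "LL m" "LS n"] n by (cases "m = 0") (simp_all add: LS SS)
  qed
  have SLt: "c (S n) (Lt m) = 0" if n: "n \<noteq> 0" for m n
  proof (cases "m + n = 0")
    case True
    then have "n = - m" by simp
    then show ?thesis
      using expand[of "LS n" "LL m"] n assms(1)
      by (simp add: SL SS field_simps power2_eq_square)
  next
    case False
    then have "n + m \<noteq> 0" by simp
    then show ?thesis
      using expand[of "LS n" "LL m"] n False by (cases "m = 0") (simp_all add: SL SS)
  qed
  have EtEt: "c (Et i m) (Et i n) =
      ((\<alpha>\<^sup>2 - 3 * \<beta>\<^sup>2) / \<alpha> * (of_int m + 1 / 2)\<^sup>2 - (\<alpha>\<^sup>2 - 3 * \<gamma>\<^sup>2) / (4 * \<alpha>)) * delta (m + n + 1)"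
    if i: "i \<in> {1..4}" for i m n
  proof (cases "m + n + 1 = 0")
    case True
    then have n: "n = - m - 1" by simp
    \<comment> \<open>In this centred coordinate n = -m - 1 becomes -x. Each of the three correction
      terms equals (\<gamma>^2 / 4 - \<beta>^2 x^2) / \<alpha>, whence the factors 3.\<close>
    define x :: complex where "x = of_int m + 1 / 2"
    have m: "of_int m = x - 1 / 2" by (simp add: x_def)
    have "c (Et i m) (Et i n) = \<alpha> * (x - 1 / 2) * (x + 1 / 2)
        + (- (\<beta> / \<alpha>) * x + \<gamma> / (2 * \<alpha>)) * (\<gamma> / 2 + \<beta> * x)
        + (\<beta> / \<alpha> * x + \<gamma> / (2 * \<alpha>)) * (\<gamma> / 2 - \<beta> * x)
        + (\<beta> / \<alpha> * x + \<gamma> / (2 * \<alpha>)) * (- (\<beta> / \<alpha>) * x + \<gamma> / (2 * \<alpha>)) * \<alpha>"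
      using expand[of "LE i m" "LE i n"] i assms(1) unfolding n
      by (simp add: EE EF FE FF m)
    also have "\<dots> = (\<alpha>\<^sup>2 - 3 * \<beta>\<^sup>2) / \<alpha> * x\<^sup>2 - (\<alpha>\<^sup>2 - 3 * \<gamma>\<^sup>2) / (4 * \<alpha>)"
      using assms(1) by (simp add: field_simps power2_eq_square)
    finally show ?thesis by (simp add: n x_def)
  next
    case False
    then have "n + m + 1 \<noteq> 0" by simp
    then show ?thesis
      using expand[of "LE i m" "LE i n"] i False by (simp add: EE EF FE FF)
  qed
  have EtF: "c (Et i m) (F i n) = (\<gamma> + \<beta> * (2 * of_int m + 1)) * delta (m + n + 1)"
    if i: "i \<in> {1..4}" for i m n
  proof -
    \<comment> \<open>Since b_m \<alpha> equals the old E-F coefficient, the correction doubles it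
      instead of cancelling it.\<close>
    have "c (Et i m) (F i n) = (\<gamma> / 2 + \<beta> * (of_int m + 1 / 2)
        + (\<beta> / (2 * \<alpha>) * (2 * of_int m + 1) + \<gamma> / (2 * \<alpha>)) * \<alpha>) * delta (m + n + 1)"
      using expand[of "LE i m" "LF i n"] i by (simp add: EF FF)
    also have "\<gamma> / 2 + \<beta> * (of_int m + 1 / 2)
        + (\<beta> / (2 * \<alpha>) * (2 * of_int m + 1) + \<gamma> / (2 * \<alpha>)) * \<alpha>
        = \<gamma> + \<beta> * (2 * of_int m + 1)"
      using assms(1) by (simp add: field_simps)
    finally show ?thesis .
  qed

  \<comment> \<open>Vanishing of the unlisted values\<close>
  have "zero_unless listed_tilde c (family Lt Et)"
    unfolding zero_unless_def
  proof (intro ballI impI)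
    fix k l
    assume kl: "k \<in> labels" "l \<in> labels" and "\<not> listed_tilde k l \<and> \<not> listed_tilde l k"
    then have unlisted: "\<not> listed_tilde k l" "\<not> listed_tilde l k" by simp_all
    have zero: "c (family L E k') (family L E l') = 0"
      if "k' \<in> labels" "l' \<in> labels" "\<not> listed k' l'" "\<not> listed l' k'" for k' l'
      using zero that unfolding zero_unless_def by blast
    show "c (family Lt Et k) (family Lt Et l) = 0"
    \<comment> \<open>The L-S pairs are the only ones listed for the old basis but not for the new
      one; there the expansion vanishes by cancellation, elsewhere term by term.\<close>
    proof (cases "(\<exists>m n. k = LL m \<and> l = LS n) \<or> (\<exists>m n. k = LS n \<and> l = LL m)")
      case True
      then show ?thesis using LtS SLt kl by auto
    next
      case False
      have kl_unlisted: "\<not> listed k l" "\<not> listed l k"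
        using False unlisted by (cases k; cases l; simp)+
      note unlisted = kl_unlisted unlisted_partner[OF kl_unlisted unlisted]
        unlisted_partner[OF kl_unlisted(2,1) unlisted(2,1)]
      show ?thesis
        unfolding expand[OF kl]
        using zero unlisted kl shear_partner(1)[of k \<alpha> \<beta> \<gamma>] shear_partner(1)[of l \<alpha> \<beta> \<gamma>]
        \<comment> \<open>A partner is known to be a label only when its coefficient is nonzero;
          otherwise its terms drop out.\<close>
        by (cases "shear \<alpha> \<beta> \<gamma> k = 0"; cases "shear \<alpha> \<beta> \<gamma> l = 0") simp_all
    qed
  qed
  moreover have "kL0_basis (family Lt Et)"
    unfolding Lt_def Et_def by (rule kL0_basis_tilde)
  moreover note TT FF SS TT_even
  moreover have "\<forall>m n. c (Lt m) (Lt n) =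
      ((\<alpha>\<^sup>2 - \<beta>\<^sup>2) / \<alpha> * of_int m ^ 3 - (\<alpha>\<^sup>2 - \<gamma>\<^sup>2) / \<alpha> * of_int m) * delta (m + n)"
    by (intro allI LtLt)
  moreover have "\<forall>i\<in>{1..4}. \<forall>m n. c (Et i m) (Et i n) =
      ((\<alpha>\<^sup>2 - 3 * \<beta>\<^sup>2) / \<alpha> * (of_int m + 1 / 2)\<^sup>2 - (\<alpha>\<^sup>2 - 3 * \<gamma>\<^sup>2) / (4 * \<alpha>)) * delta (m + n + 1)"
    by (intro ballI allI EtEt)
  moreover have "\<forall>i\<in>{1..4}. \<forall>m n.
      c (Et i m) (F i n) = (\<gamma> + \<beta> * (2 * of_int m + 1)) * delta (m + n + 1)"
    by (intro ballI allI EtF)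
  moreover have "\<forall>m n. n \<noteq> 0 \<longrightarrow> c (Lt m) (S n) = 0"
    by (intro allI impI LtS)
  ultimately show ?thesis
    using Lt0 by (intro conjI)
qed

end
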